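(* Suppose that Assumption 1 and Assumption 2(ii) (both stated in the context) hold, that $\{(x^k,y^k,z^k)\}_{k\ge0}$ is a sequence generated by the PL-ADMM algorithm which is bounded, and that $\mathcal R$ satisfies the Kurdyka-Łojasiewicz property on the set $\Omega$ of limit points of $\{(x^k,y^k,z^k,y^{k-1},z^{k-1})\}_{k\ge1}$; that is, for every $v^*=(x^*,y^*,z^*,y^*,z^* )\in\Omega$ there exist $\epsilon>0$, $\eta\in(0,+\infty)$ and $\psi\in\Psi_\eta$ such that for every $v=(x,y,z,y',z')\in\mathbb R^n\times\mathbb R^m\times\mathbb R^p\times\mathbb R^m\times\mathbb R^p$ with ${\rm dist}(v,\Omega)<\epsilon$ and $\mathcal R(v^* )<\mathcal R(v)<\mathcal R(v^* )+\eta$ one has $$\psi'\big(\mathcal R(v)-\mathcal R(v^* )\big)\,{\rm dist}\big(0,\partial\mathcal R(v)\big)\ge1.$$ Then $\{(x^k,y^k,z^k)\}_{k\ge0}$ satisfies the finite length property $$\sum_{k=1}^{\infty}\big(\|\Delta x^k\|+\|\Delta y^k\|+\|\Delta z^k\|\big)<+\infty,$$ and consequently converges to a stationary point of the problem, i.e. to a point $(x^*,y^*,z^* )$ with $0\in\partial f(x^* )+\nabla g(x^* )+A^*z^*$, $0=\nabla h(y^* )+B^*z^*$, $0=Ax^*+By^*+c$.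
   Context: Setting. $A\in\mathbb R^{p\times n}$, $B\in\mathbb R^{p\times m}$, $c\in\mathbb R^p$; $A^*,B^*$ are the transposes; $\|\cdot\|$ is the Euclidean norm (operator norm for matrices); $\|v\|_Q^2=\langle v,Qv\rangle$ for symmetric $Q$. $\partial$ is the limiting (Mordukhovich) subdifferential; ${\rm dist}(x,S)=\inf_{s\in S}\|x-s\|$, equal to $+\infty$ if $S=\emptyset$. $f:\mathbb R^n\to\mathbb R\cup\{+\infty\}$ is proper; $g:\mathbb R^n\to\mathbb R$ and $h:\mathbb R^m\to\mathbb R$ are differentiable; none is assumed convex. The problem is $\min_{x,y} f(x)+g(x)+h(y)$ subject to $Ax+By+c=0$. For $\alpha>0$, $\mathcal L^{\alpha}(x,y,z)=f(x)+g(x)+h(y)+\langle z,Ax+By+c\rangle+\frac{\alpha}{2}\|Ax+By+c\|^2$, $z\in\mathbb R^p$. For $\eta\in(0,+\infty]$, $\Psi_\eta$ is the set of continuous concave functions $\psi:[0,\eta]\to[0,+\infty)$ with $\psi(0)=0$, $\psi$ continuously differentiable on $(0,\eta)$ and $\psi'>0$ on $(0,\eta)$. PL-ADMM algorithm. Given symmetric positive semidefinite matrices $Q_1^k\in\mathbb R^{n\times n}$, $Q_2^k\in\mathbb R^{m\times m}$ ($k\ge0$) and $(x^0,y^0,z^0)$, for $k\ge 0$: $x^{k+1}\in\arg\min_x\{ f(x)+\langle\nabla g(x^k)+\alpha A^*(Ax^k+By^k+c+\alpha^{-1}z^k),x-x^k\rangle+\frac12\|x-x^k\|^2_{Q_1^k}\}$,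 $y^{k+1}=\arg\min_y\{\langle\nabla h(y^k)+B^*z^k,y-y^k\rangle+\frac{\alpha}{2}\|By+Ax^{k+1}+c\|^2+\frac12\|y-y^k\|^2_{Q_2^k}\}$, $z^{k+1}=z^k+\alpha\beta(Ax^{k+1}+By^{k+1}+c)$. Write $\Delta u^{k}=u^{k}-u^{k-1}$ for $k\ge1$. A limit point is the limit of some subsequence. Assumption 1. (A1) $f$ is lower semicontinuous and coercive; (A2) $g$ is coercive and $h$ is bounded from below; (A3) $B$ has full column rank (so $B^*B$ is invertible), ${\rm Im}(A)\subseteq{\rm Im}(B)$ and $c\in{\rm Im}(B)$; (A4) $\nabla g$ and $\nabla h$ are Lipschitz continuous with constants $L_g$ and $L_h$; (A5) $\alpha>0$, $\beta\in(0,2)$, $q_i^-:=\inf_{k\ge0}\|Q_i^k\|\ge0$ and $q_i:=\sup_{k\ge0}\|Q_i^k\|<+\infty$, $i=1,2$. Constants. $\lambda_{\max}^{X}$ and $\lambda_+^{X}$ are the largest and the smallest positive eigenvalue of $X$. $\theta_0=\frac{2\beta(L_h+q_2)^2}{\alpha\lambda_+^{B^*B}(1-|1-\beta|)^2}$, $\theta_1=\frac{2\beta q_2^2}{\alpha\lambda_+^{B^*B}(1-|1-\beta|)^2}$, $\gamma_0=\frac{|1-\beta|}{\alpha\beta\lambda_+^{B^*B}(1-|1-\beta|)}$. For a fixed $r>1$, $\mathcal R(x,y,z,y',z')=\mathcal L^\alpha(x,y,z)+r\gamma_0\|B^*(z-z')\|^2+r\theta_0\|y-y'\|^2$ and $\mathcal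 R_k=\mathcal R(x^k,y^k,z^k,y^{k-1},z^{k-1})$ for $k\ge1$. Assumption 2(ii) (relaxed sufficient decrease condition). The parameters $\alpha>0$, $\beta\in(0,2)$, $r>1$ and the matrices $Q_1^k,Q_2^k$ are such that for some $k_0\ge1$ and $\sigma>0$, $\inf_{k\ge k_0}\{\|Q_1^k\|-\alpha\lambda_{\max}^{A^*A}-L_g,\ \|Q_2^k\|+\alpha\lambda_+^{B^*B}-(L_h+r\theta_0+r\theta_1),\ \frac{r-1}{\alpha\beta}\}>\sigma$, and with this the sufficient decrease inequality $\mathcal R_{k+1}+\sigma(\|\Delta x^{k+1}\|^2+\|\Delta y^{k+1}\|^2+\|\Delta z^{k+1}\|^2)\le\mathcal R_k\le\mathcal R_{k_0}$ holds for all $k\ge k_0$. *)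

theory Defs
  imports "HOL-Analysis.Analysis"
begin

definition proper :: "('a \<Rightarrow> ereal) \<Rightarrow> bool" where
  "proper F \<longleftrightarrow> (\<forall>x. F x \<noteq> - \<infinity>) \<and> (\<exists>x. F x \<noteq> \<infinity>)"

definition lower_semicontinuous :: "('a::topological_space \<Rightarrow> ereal) \<Rightarrow> bool" where
  "lower_semicontinuous F \<longleftrightarrow> (\<forall>x. F x \<le> Liminf (at x) F)"

definition frechet_subdiff :: "('a::real_inner \<Rightarrow> ereal) \<Rightarrow> 'a \<Rightarrow> 'a set" where
  "frechet_subdiff F x =
    {u. \<bar>F x\<bar> \<noteq> \<infinity> \<and>
        0 \<le> Liminf (at x) (\<lambda>y. (F y - F x - ereal (u \<bullet> (y - x))) / ereal (norm (y - x)))}"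

text \<open>Mordukhovich's subdifferential; both subdifferentials are empty where \<open>F\<close> is infinite.\<close>

definition limiting_subdiff :: "('a::real_inner \<Rightarrow> ereal) \<Rightarrow> 'a \<Rightarrow> 'a set" where
  "limiting_subdiff F x =
    {u. \<bar>F x\<bar> \<noteq> \<infinity> \<and>
        (\<exists>X U. X \<longlonglongrightarrow> x \<and> (\<lambda>k. F (X k)) \<longlonglongrightarrow> F x \<and>
               (\<forall>k. U k \<in> frechet_subdiff F (X k)) \<and> U \<longlonglongrightarrow> u)}"

text \<open>Unlike the library's \<open>infdist\<close>, the distance to the empty set is \<open>\<infinity>\<close>.\<close>

definition edist_set :: "'a::real_normed_vector \<Rightarrow> 'a set \<Rightarrow> ereal" where
  "edist_set x S = (INF s\<in>S. ereal (norm (x - s)))"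

definition limit_points :: "(nat \<Rightarrow> 'a::topological_space) \<Rightarrow> 'a set" where
  "limit_points u = {w. \<exists>s. strict_mono s \<and> (u \<circ> s) \<longlonglongrightarrow> w}"

definition desingularizing :: "real \<Rightarrow> (real \<Rightarrow> real) set" where
  "desingularizing \<eta> =
    {\<psi>. continuous_on {0..\<eta>} \<psi> \<and> concave_on {0..\<eta>} \<psi> \<and> (\<forall>t\<in>{0..\<eta>}. 0 \<le> \<psi> t) \<and> \<psi> 0 = 0 \<and>
         \<psi> C1_differentiable_on {0<..<\<eta>} \<and> (\<forall>t\<in>{0<..<\<eta>}. 0 < deriv \<psi> t)}"

text \<open>
  The Kurdyka--Lojasiewicz inequality for \<open>F\<close> at the point \<open>w\<close> of \<open>\<Omega>\<close>, on a neighbourhood of the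
  whole set \<open>\<Omega>\<close>. The two strict inequalities force \<open>F v\<close> and \<open>F w\<close> to be finite as soon as \<open>F\<close>
  never takes the value \<open>- \<infinity>\<close>, so \<open>real_of_ereal\<close> is then harmless.
\<close>

definition KL_at :: "('a::real_inner \<Rightarrow> ereal) \<Rightarrow> 'a set \<Rightarrow> 'a \<Rightarrow> bool" where
  "KL_at F \<Omega> w \<longleftrightarrow>
    (\<exists>\<epsilon>>0. \<exists>\<eta>>0. \<exists>\<psi>\<in>desingularizing \<eta>.
      \<forall>v. edist_set v \<Omega> < ereal \<epsilon> \<and> F w < F v \<and> F v < F w + ereal \<eta> \<longrightarrow>
          ereal (deriv \<psi> (real_of_ereal (F v - F w))) * edist_set 0 (limiting_subdiff F v) \<ge> 1)"

text \<open>The library norm on matrices is the Frobenius norm; the operator norm is needed here.\<close>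

abbreviation opnorm :: "real^'n^'m \<Rightarrow> real" where
  "opnorm M \<equiv> onorm ((*v) M)"

definition sqnorm :: "real^'n^'n \<Rightarrow> real^'n \<Rightarrow> real" where
  "sqnorm Q v = v \<bullet> (Q *v v)"

definition sym_psd :: "real^'n^'n \<Rightarrow> bool" where
  "sym_psd Q \<longleftrightarrow> transpose Q = Q \<and> (\<forall>v. 0 \<le> v \<bullet> (Q *v v))"

definition eigenvalues :: "real^'n^'n \<Rightarrow> real set" where
  "eigenvalues M = {l. \<exists>v. v \<noteq> 0 \<and> M *v v = l *\<^sub>R v}"

definition lambda_max :: "real^'n^'n \<Rightarrow> real" where
  "lambda_max M = Max (eigenvalues M)"

definition lambda_pos :: "real^'n^'n \<Rightarrow> real" where
  "lambda_pos M = Min {l \<in> eigenvalues M. 0 < l}"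

definition aug_lagrangian ::
  "(real^'n \<Rightarrow> ereal) \<Rightarrow> (real^'n \<Rightarrow> real) \<Rightarrow> (real^'m \<Rightarrow> real) \<Rightarrow>
   real^'n^'p \<Rightarrow> real^'m^'p \<Rightarrow> real^'p \<Rightarrow> real \<Rightarrow>
   real^'n \<Rightarrow> real^'m \<Rightarrow> real^'p \<Rightarrow> ereal" where
  "aug_lagrangian f g h A B c \<alpha> x y z =
    f x + ereal (g x + h y + z \<bullet> (A *v x + B *v y + c) + \<alpha> / 2 * (norm (A *v x + B *v y + c))\<^sup>2)"

definition theta0 :: "real^'m^'p \<Rightarrow> real \<Rightarrow> real \<Rightarrow> real \<Rightarrow> real \<Rightarrow> real" where
  "theta0 B \<alpha> \<beta> L\<^sub>h q\<^sub>2 =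
    2 * \<beta> * (L\<^sub>h + q\<^sub>2)\<^sup>2 / (\<alpha> * lambda_pos (transpose B ** B) * (1 - \<bar>1 - \<beta>\<bar>)\<^sup>2)"

definition theta1 :: "real^'m^'p \<Rightarrow> real \<Rightarrow> real \<Rightarrow> real \<Rightarrow> real" where
  "theta1 B \<alpha> \<beta> q\<^sub>2 =
    2 * \<beta> * q\<^sub>2\<^sup>2 / (\<alpha> * lambda_pos (transpose B ** B) * (1 - \<bar>1 - \<beta>\<bar>)\<^sup>2)"

definition gamma0 :: "real^'m^'p \<Rightarrow> real \<Rightarrow> real \<Rightarrow> real" where
  "gamma0 B \<alpha> \<beta> =
    \<bar>1 - \<beta>\<bar> / (\<alpha> * \<beta> * lambda_pos (transpose B ** B) * (1 - \<bar>1 - \<beta>\<bar>))"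

definition reg_lagrangian ::
  "(real^'n \<Rightarrow> ereal) \<Rightarrow> (real^'n \<Rightarrow> real) \<Rightarrow> (real^'m \<Rightarrow> real) \<Rightarrow>
   real^'n^'p \<Rightarrow> real^'m^'p \<Rightarrow> real^'p \<Rightarrow> real \<Rightarrow> real \<Rightarrow> real \<Rightarrow> real \<Rightarrow> real \<Rightarrow>
   (real^'n) \<times> (real^'m) \<times> (real^'p) \<times> (real^'m) \<times> (real^'p) \<Rightarrow> ereal" where
  "reg_lagrangian f g h A B c \<alpha> \<beta> r L\<^sub>h q\<^sub>2 = (\<lambda>(x, y, z, y', z').
    aug_lagrangian f g h A B c \<alpha> x y z +
    ereal (r * gamma0 B \<alpha> \<beta> * (norm (transpose B *v (z - z')))\<^sup>2 +
           r * theta0 B \<alpha> \<beta> L\<^sub>h q\<^sub>2 * (norm (y - y'))\<^sup>2))"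

text \<open>
  \<open>G\<close> and \<open>H\<close> are the gradients of \<open>g\<close> and \<open>h\<close>. The minimizer in the second step is unique
  whenever \<open>B\<close> has full column rank and \<open>\<alpha> > 0\<close>, so \<open>is_arg_min\<close> determines it.
\<close>

definition PL_ADMM ::
  "(real^'n \<Rightarrow> ereal) \<Rightarrow> (real^'n \<Rightarrow> real^'n) \<Rightarrow> (real^'m \<Rightarrow> real^'m) \<Rightarrow>
   real^'n^'p \<Rightarrow> real^'m^'p \<Rightarrow> real^'p \<Rightarrow> real \<Rightarrow> real \<Rightarrow>
   (nat \<Rightarrow> real^'n^'n) \<Rightarrow> (nat \<Rightarrow> real^'m^'m) \<Rightarrow>
   (nat \<Rightarrow> real^'n) \<Rightarrow> (nat \<Rightarrow> real^'m) \<Rightarrow> (nat \<Rightarrow> real^'p) \<Rightarrow> bool" where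
  "PL_ADMM f G H A B c \<alpha> \<beta> Q\<^sub>1 Q\<^sub>2 x y z \<longleftrightarrow>
    (\<forall>k. sym_psd (Q\<^sub>1 k) \<and> sym_psd (Q\<^sub>2 k)) \<and>
    (\<forall>k.
      is_arg_min
        (\<lambda>w. f w +
          ereal ((G (x k) + \<alpha> *\<^sub>R (transpose A *v (A *v x k + B *v y k + c + (1 / \<alpha>) *\<^sub>R z k)))
                   \<bullet> (w - x k)
                 + 1 / 2 * sqnorm (Q\<^sub>1 k) (w - x k)))
        (\<lambda>_. True) (x (Suc k)) \<and>
      is_arg_min
        (\<lambda>w. (H (y k) + transpose B *v z k) \<bullet> (w - y k)
             + \<alpha> / 2 * (norm (B *v w + A *v x (Suc k) + c))\<^sup>2
             + 1 / 2 * sqnorm (Q\<^sub>2 k) (w - y k))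
        (\<lambda>_. True) (y (Suc k)) \<and>
      z (Suc k) = z k + (\<alpha> * \<beta>) *\<^sub>R (A *v x (Suc k) + B *v y (Suc k) + c))"

text \<open>
  The iterates in the domain of \<open>reg_lagrangian\<close>; only meaningful for \<open>k \<ge> 1\<close>, since \<open>0 - 1 = 0\<close>.
\<close>

definition ext_iterate ::
  "(nat \<Rightarrow> 'x) \<Rightarrow> (nat \<Rightarrow> 'y) \<Rightarrow> (nat \<Rightarrow> 'z) \<Rightarrow> nat \<Rightarrow> 'x \<times> 'y \<times> 'z \<times> 'y \<times> 'z" where
  "ext_iterate x y z k = (x k, y k, z k, y (k - 1), z (k - 1))"

definition stationary_point ::
  "(real^'n \<Rightarrow> ereal) \<Rightarrow> (real^'n \<Rightarrow> real^'n) \<Rightarrow> (real^'m \<Rightarrow> real^'m) \<Rightarrow>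
   real^'n^'p \<Rightarrow> real^'m^'p \<Rightarrow> real^'p \<Rightarrow> real^'n \<Rightarrow> real^'m \<Rightarrow> real^'p \<Rightarrow> bool" where
  "stationary_point f G H A B c x y z \<longleftrightarrow>
    0 \<in> (\<lambda>u. u + G x + transpose A *v z) ` limiting_subdiff f x \<and>
    0 = H y + transpose B *v z \<and>
    0 = A *v x + B *v y + c"

end

theory Submission
  imports Defs
begin

text \<open>
  The optimality conditions of the two subproblems give an element of \<open>\<partial>R\<close> at the iterate
  \<open>(x k, y k, z k, y (k - 1), z (k - 1))\<close> whose norm is bounded by a multiple of the last step
  length. Lower semicontinuity and the minimality of \<open>x (k + 1)\<close> show that \<open>R\<close> along the iterates
  decreases to a limit, which is the value of \<open>R\<close> on all of \<open>\<Omega>\<close>. The KL inequality then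
  applies near \<open>\<Omega>\<close> and, with the descent inequality, makes the step lengths summable.
  Passing to the limit in the optimality conditions yields stationarity.
\<close>

section \<open>Frechet subgradients of extended-real functions\<close>

lemma ereal_quotient_ge_iff:
  fixes F :: ereal
  assumes "n > 0"
  shows "ereal (- e) \<le> (F - ereal a - ereal t) / ereal n \<longleftrightarrow> ereal a + ereal (t - e * n) \<le> F"
proof (cases F)
  case (real b)
  have "- e \<le> (b - a - t) / n \<longleftrightarrow> a + (t - e * n) \<le> b"
    using assms by (simp add: pos_le_divide_eq) argo
  then show ?thesis using assms by (simp add: real del: divide_le_0_iff)
qed (use assms in auto)

text \<open>Clearing the denominator replaces the Liminf of difference quotients by an inequality
  without \<open>ereal\<close> division. At \<open>y = x\<close> this inequality is trivial, so the
  punctured filter can give way to \<open>nhds x\<close>, which, unlike \<open>at x\<close>, pulls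
  back along the projection \<open>fst\<close>.\<close>

lemma frechet_subdiff_iff:
  fixes F :: "'a::real_inner \<Rightarrow> ereal"
  shows "u \<in> frechet_subdiff F x \<longleftrightarrow>
    \<bar>F x\<bar> \<noteq> \<infinity> \<and>
    (\<forall>e>0. \<forall>\<^sub>F y in nhds x. F x + ereal (u \<bullet> (y - x) - e * norm (y - x)) \<le> F y)"
    (is "_ \<longleftrightarrow> ?fin \<and> ?R")
proof (cases ?fin)
  case True
  then obtain a where a: "F x = ereal a" by auto
  define q where "q y = (F y - F x - ereal (u \<bullet> (y - x))) / ereal (norm (y - x))" for y
  have q: "ereal (- e) \<le> q y \<longleftrightarrow> F x + ereal (u \<bullet> (y - x) - e * norm (y - x)) \<le> F y"
    if "y \<noteq> x" for e y
    unfolding q_def a by (rule ereal_quotient_ge_iff) (use that in simp)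
  have "0 \<le> Liminf (at x) q \<longleftrightarrow> (\<forall>e>0. \<forall>\<^sub>F y in at x. ereal (- e) \<le> q y)"
  proof
    assume L: "0 \<le> Liminf (at x) q"
    show "\<forall>e>0. \<forall>\<^sub>F y in at x. ereal (- e) \<le> q y"
    proof (intro allI impI)
      fix e :: real assume "e > 0"
      then have "ereal (- e) < 0" by simp
      with L have "\<forall>\<^sub>F y in at x. ereal (- e) < q y" unfolding le_Liminf_iff by blast
      then show "\<forall>\<^sub>F y in at x. ereal (- e) \<le> q y" by eventually_elim simp
    qed
  next
    assume R: "\<forall>e>0. \<forall>\<^sub>F y in at x. ereal (- e) \<le> q y"
    show "0 \<le> Liminf (at x) q"
      unfolding le_Liminf_iff
    proof (intro allI impI)
      fix b :: ereal assume "b < 0"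
      then obtain t where t: "b < ereal t" "ereal t < 0" using ereal_dense2 by blast
      with R[rule_format, of "- t"] have "\<forall>\<^sub>F y in at x. ereal t \<le> q y" by simp
      then show "\<forall>\<^sub>F y in at x. b < q y" by eventually_elim (use t in order)
    qed
  qed
  also have "\<dots> \<longleftrightarrow> ?R"
  proof -
    have "(\<forall>\<^sub>F y in at x. ereal (- e) \<le> q y) \<longleftrightarrow>
        (\<forall>\<^sub>F y in nhds x. F x + ereal (u \<bullet> (y - x) - e * norm (y - x)) \<le> F y)" for e
      unfolding eventually_at_filter
      by (intro eventually_cong eventually_True refl eventuallyI) (auto simp: q a)
    then show ?thesis by simp
  qed
  finally show ?thesis using True by (simp add: frechet_subdiff_def q_def[abs_def])
qed (simp add: frechet_subdiff_def)

lemma frechet_subdiff_subset_limiting: "frechet_subdiff F x \<subseteq> limiting_subdiff F x"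
proof
  fix u assume u: "u \<in> frechet_subdiff F x"
  then have "\<bar>F x\<bar> \<noteq> \<infinity>" by (simp add: frechet_subdiff_iff)
  then show "u \<in> limiting_subdiff F x"
    unfolding limiting_subdiff_def
    by (intro CollectI conjI exI[of _ "\<lambda>_. x"] exI[of _ "\<lambda>_. u"]) (use u in auto)
qed

text \<open>The error \<open>e\<close> is split evenly between \<open>F\<close> and the first-order
  expansion of \<open>p\<close>. This one inclusion yields the full sum rule, since
  \<open>- p\<close> can be added afterwards.\<close>

lemma frechet_subdiff_add_smooth:
  fixes F :: "'a::real_inner \<Rightarrow> ereal"
  assumes u: "u \<in> frechet_subdiff F x" and p: "GDERIV p x :> v"
  shows "u + v \<in> frechet_subdiff (\<lambda>w. F w + ereal (p w)) x"
  unfolding frechet_subdiff_iff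
proof (intro conjI allI impI)
  show "\<bar>F x + ereal (p x)\<bar> \<noteq> \<infinity>" using u by (auto simp: frechet_subdiff_iff)
  fix e :: real assume e: "e > 0"
  have "\<forall>\<^sub>F y in nhds x. F x + ereal (u \<bullet> (y - x) - e / 2 * norm (y - x)) \<le> F y"
    using u e half_gt_zero unfolding frechet_subdiff_iff by blast
  moreover have "\<forall>\<^sub>F y in nhds x. norm (p y - p x - (y - x) \<bullet> v) \<le> e / 2 * norm (y - x)"
  proof -
    have "\<exists>d>0. \<forall>y\<in>UNIV. norm (y - x) < d \<longrightarrow> norm (p y - p x - (y - x) \<bullet> v) \<le> e / 2 * norm (y - x)"
      using p e half_gt_zero unfolding gderiv_def has_derivative_within_alt by blast
    then show ?thesis unfolding eventually_nhds_metric dist_norm by simp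
  qed
  ultimately show "\<forall>\<^sub>F y in nhds x.
      F x + ereal (p x) + ereal ((u + v) \<bullet> (y - x) - e * norm (y - x)) \<le> F y + ereal (p y)"
  proof eventually_elim
    case (elim y)
    have "p x + (u + v) \<bullet> (y - x) - e * norm (y - x)
        \<le> (u \<bullet> (y - x) - e / 2 * norm (y - x)) + p y"
      using elim(2) unfolding inner_add_left inner_commute[of v] real_norm_def abs_le_iff by argo
    with elim(1) show ?case by (cases "F x"; cases "F y") auto
  qed
qed

text \<open>Lifts subgradients of \<open>f\<close> to the product space on which \<open>R\<close>
  lives. The projection does not increase norms, so the error term on the product dominates the one
  on the factor.\<close>

lemma frechet_subdiff_comp_fst:
  assumes "u \<in> frechet_subdiff F x"
  shows "(u, 0) \<in> frechet_subdiff (\<lambda>v. F (fst v)) (x, y)"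
  unfolding frechet_subdiff_iff
proof (intro conjI allI impI)
  show "\<bar>F (fst (x, y))\<bar> \<noteq> \<infinity>" using assms by (simp add: frechet_subdiff_iff)
  fix e :: real assume e: "e > 0"
  have "\<forall>\<^sub>F w in nhds x. F x + ereal (u \<bullet> (w - x) - e * norm (w - x)) \<le> F w"
    using assms e by (simp add: frechet_subdiff_iff)
  moreover have "filterlim fst (nhds x) (nhds (x, y))"
    using filterlim_fst by (simp add: nhds_prod)
  ultimately have "\<forall>\<^sub>F v in nhds (x, y).
      F x + ereal (u \<bullet> (fst v - x) - e * norm (fst v - x)) \<le> F (fst v)"
    by (rule eventually_compose_filterlim)
  then show "\<forall>\<^sub>F v in nhds (x, y). F (fst (x, y)) +
      ereal ((u, 0) \<bullet> (v - (x, y)) - e * norm (v - (x, y))) \<le> F (fst v)"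
  proof eventually_elim
    case (elim v)
    have "norm (fst v - x) \<le> norm (v - (x, y))"
      using norm_fst_le[of "fst v - x" "snd v - y"] by (cases v) simp
    then have "e * norm (fst v - x) \<le> e * norm (v - (x, y))"
      using e by simp
    then have "F x + ereal ((u, 0) \<bullet> (v - (x, y)) - e * norm (v - (x, y))) \<le>
        F x + ereal (u \<bullet> (fst v - x) - e * norm (fst v - x))"
      by (intro add_left_mono) (simp add: inner_prod_def)
    with elim show ?case by simp
  qed
qed

text \<open>Fermat's rule for a sum: 0 is a Frechet subgradient of \<open>F + p\<close> at the
  minimizer, and adding \<open>- p\<close> leaves a subgradient of \<open>F\<close>.\<close>

lemma frechet_subdiff_if_minimizer:
  assumes fin: "\<bar>F x\<bar> \<noteq> \<infinity>" and min: "\<And>w. F x + ereal (p x) \<le> F w + ereal (p w)"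
    and p: "GDERIV p x :> v"
  shows "- v \<in> frechet_subdiff F x"
proof -
  have "0 \<in> frechet_subdiff (\<lambda>w. F w + ereal (p w)) x"
    unfolding frechet_subdiff_iff
  proof (intro conjI allI impI)
    show "\<bar>F x + ereal (p x)\<bar> \<noteq> \<infinity>" using fin by auto
    fix e :: real assume "e > 0"
    then have "F x + ereal (p x) + ereal (0 \<bullet> (w - x) - e * norm (w - x)) \<le> F x + ereal (p x)" for w
      using fin by (cases "F x") auto
    then show "\<forall>\<^sub>F w in nhds x. F x + ereal (p x) + ereal (0 \<bullet> (w - x) - e * norm (w - x))
        \<le> F w + ereal (p w)"
      using min by (intro always_eventually allI) (blast intro: order_trans)
  qed
  from frechet_subdiff_add_smooth[OF this GDERIV_minus[OF p]]
  have "- v \<in> frechet_subdiff (\<lambda>w. F w + ereal (p w) + ereal (- p w)) x" by simp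
  moreover have "F w + ereal (p w) + ereal (- p w) = F w" for w by (cases "F w") auto
  ultimately show ?thesis by simp
qed

section \<open>Adjoints and gradients of the smooth terms\<close>

lemma inner_transpose:
  fixes M :: "real^'n^'m"
  shows "v \<bullet> (transpose M *v w) = (M *v v) \<bullet> w"
  by (metis dot_lmul_matrix transpose_matrix_vector transpose_transpose)

lemma gderiv_half_norm_sq_affine:
  fixes M :: "real^'n^'m"
  shows "GDERIV (\<lambda>w. a / 2 * (norm (M *v w + e))\<^sup>2) w :> a *\<^sub>R (transpose M *v (M *v w + e))"
  unfolding gderiv_def power2_norm_eq_inner
  by (rule derivative_eq_intros bounded_linear.has_derivative[OF matrix_vector_mul_bounded_linear] refl)+
    (simp add: fun_eq_iff inner_transpose inner_commute del: transpose_matrix_vector)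

text \<open>Symmetry of \<open>Q\<close> makes the two terms of the product rule equal, which
  absorbs the factor 1/2.\<close>

lemma gderiv_linear_half_sqnorm:
  assumes "transpose Q = Q"
  shows "GDERIV (\<lambda>w. p \<bullet> (w - x) + 1 / 2 * sqnorm Q (w - x)) w :> p + Q *v (w - x)"
proof -
  have "(w - x) \<bullet> (Q *v v) = v \<bullet> (Q *v (w - x))" for v
    by (metis assms inner_transpose inner_commute)
  then show ?thesis
    unfolding gderiv_def sqnorm_def
    by - ((rule derivative_eq_intros bounded_linear.has_derivative[OF matrix_vector_mul_bounded_linear] refl)+,
        simp add: fun_eq_iff inner_commute[of p] inner_add_right)
qed

text \<open>The smooth part of \<open>reg_lagrangian\<close>, that is, everything but
  \<open>f\<close>, with free weights for the two regularising squares. All nonsmoothness of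
  \<open>R\<close> thus sits in its first block.\<close>

definition coupling ::
  "(real^'n \<Rightarrow> real) \<Rightarrow> (real^'m \<Rightarrow> real) \<Rightarrow> real^'n^'p \<Rightarrow> real^'m^'p \<Rightarrow> real^'p \<Rightarrow> real \<Rightarrow> real \<Rightarrow> real \<Rightarrow>
   (real^'n) \<times> (real^'m) \<times> (real^'p) \<times> (real^'m) \<times> (real^'p) \<Rightarrow> real" where
  "coupling g h A B c \<alpha> a b = (\<lambda>(x, y, z, y', z').
    g x + h y + z \<bullet> (A *v x + B *v y + c) + \<alpha> / 2 * (norm (A *v x + B *v y + c))\<^sup>2 +
    a * (norm (transpose B *v (z - z')))\<^sup>2 + b * (norm (y - y'))\<^sup>2)"

lemma reg_lagrangian_eq_coupling:
  "reg_lagrangian f g h A B c \<alpha> \<beta> r L q v =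
    f (fst v) + ereal (coupling g h A B c \<alpha> (r * gamma0 B \<alpha> \<beta>) (r * theta0 B \<alpha> \<beta> L q) v)"
  by (cases v; cases "f (fst v)")
    (auto simp: reg_lagrangian_def aug_lagrangian_def coupling_def add.assoc)

lemma gderiv_coupling:
  fixes A :: "real^'n^'p" and B :: "real^'m^'p" and c :: "real^'p"
  assumes "GDERIV g x :> Gx" "GDERIV h y :> Hy"
  defines "res \<equiv> A *v x + B *v y + c"
  shows "GDERIV (coupling g h A B c \<alpha> a b) (x, y, z, y', z') :>
    (Gx + transpose A *v z + \<alpha> *\<^sub>R (transpose A *v res),
     Hy + transpose B *v z + \<alpha> *\<^sub>R (transpose B *v res) + (2 * b) *\<^sub>R (y - y'),
     res + (2 * a) *\<^sub>R (B *v (transpose B *v (z - z'))),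
     - (2 * b) *\<^sub>R (y - y'),
     - (2 * a) *\<^sub>R (B *v (transpose B *v (z - z'))))"
proof -
  \<comment> \<open>Projections and inner products replace the tuple pattern and the norms, so that
    the derivative rules apply.\<close>
  have *: "coupling g h A B c \<alpha> a b = (\<lambda>v.
    g (fst v) + h (fst (snd v)) + fst (snd (snd v)) \<bullet> (A *v fst v + B *v fst (snd v) + c) +
    \<alpha> / 2 * ((A *v fst v + B *v fst (snd v) + c) \<bullet> (A *v fst v + B *v fst (snd v) + c)) +
    a * ((transpose B *v (fst (snd (snd v)) - snd (snd (snd (snd v))))) \<bullet>
         (transpose B *v (fst (snd (snd v)) - snd (snd (snd (snd v)))))) +
    b * ((fst (snd v) - fst (snd (snd (snd v)))) \<bullet> (fst (snd v) - fst (snd (snd (snd v))))))"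
    by (auto simp: coupling_def fun_eq_iff power2_norm_eq_inner)
  have g: "(g has_derivative (\<lambda>d. d \<bullet> Gx)) (at x)" and h: "(h has_derivative (\<lambda>d. d \<bullet> Hy)) (at y)"
    using assms by (auto simp: gderiv_def)
  have g': "((\<lambda>v. g (fst v)) has_derivative (\<lambda>d. fst d \<bullet> Gx)) (at (x, y, z, y', z'))"
    by (rule has_derivative_compose[of fst fst _ _ g, simplified]) (auto intro: g derivative_intros)
  have h': "((\<lambda>v. h (fst (snd v))) has_derivative (\<lambda>d. fst (snd d) \<bullet> Hy)) (at (x, y, z, y', z'))"
    by (rule has_derivative_compose[of "\<lambda>v. fst (snd v)" "\<lambda>v. fst (snd v)" _ _ h, simplified])
      (auto intro: h has_derivative_fst[OF has_derivative_snd[OF has_derivative_ident]])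
  \<comment> \<open>Lets the derivative of the term weighted by \<open>a\<close> be compared with
    the inner product against \<open>B *v (transpose B *v (z - z'))\<close>.\<close>
  have BBt: "u \<bullet> (B *v (transpose B *v v)) = (transpose B *v u) \<bullet> (transpose B *v v)" for u v
    by (metis inner_transpose inner_commute)
  define s t where "s = y - y'" and "t = z - z'"
  show ?thesis
    unfolding gderiv_def *
    by (rule has_derivative_eq_rhs,
        (rule derivative_intros g' h'
          bounded_linear.has_derivative[OF matrix_vector_mul_bounded_linear])+)
      (simp add: fun_eq_iff res_def[symmetric] s_def[symmetric] t_def[symmetric]
        inner_prod_def BBt inner_transpose inner_add_right inner_add_left inner_diff_left
        matrix_vector_mult_diff_distrib inner_commute[of z] inner_commute[of res]
        inner_commute[of s] inner_commute[of "transpose B *v t"] del: transpose_matrix_vector,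
       simp add: algebra_simps)
qed

section \<open>Summability of the steps under the KL inequality\<close>

lemma summable_if_telescoping:
  fixes d p :: "nat \<Rightarrow> real"
  assumes nonneg: "\<And>k. 0 \<le> d k" "\<And>k. 0 \<le> p k"
    and step: "\<And>k. 2 * d (Suc k) \<le> d k + p k - p (Suc k)"
  shows "summable d"
proof -
  \<comment> \<open>Of the two copies of \<open>d (Suc k)\<close>, one cancels the \<open>d\<close>
    of the next step and the other enters the sum; \<open>p\<close> telescopes.\<close>
  have "(\<Sum>k<n. d (Suc k)) + d n + p n \<le> d 0 + p 0" for n
  proof (induction n)
    case (Suc n)
    then show ?case using step[of n] by simp
  qed simp
  then have "(\<Sum>k<n. d (Suc k)) \<le> d 0 + p 0" for n
    using nonneg[of n] by (smt (verit))
  then have "summable (\<lambda>k. d (Suc k))"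
    by (intro summableI_nonneg_bounded) (use nonneg in auto)
  then show ?thesis by (simp add: summable_Suc_iff)
qed

text \<open>Compactness: infinitely many terms at distance at least \<open>e\<close> would have a
  convergent subsequence, whose limit is a limit point closer than \<open>e\<close> to some of them.
  As the distance to the empty set is \<infinity>, the claim also contains the existence of limit
  points.\<close>

lemma edist_set_limit_points:
  fixes u :: "nat \<Rightarrow> 'a::euclidean_space"
  assumes bdd: "bounded (range u)" and e: "e > 0"
  shows "\<forall>\<^sub>F k in sequentially. edist_set (u k) (limit_points u) < ereal e"
proof (rule ccontr)
  assume "\<not> ?thesis"
  then have inf: "infinite {k. \<not> edist_set (u k) (limit_points u) < ereal e}"
    by (simp add: not_eventually frequently_cofinite[symmetric] cofinite_eq_sequentially)
  define s where "s = enumerate {k. \<not> edist_set (u k) (limit_points u) < ereal e}"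
  have s: "strict_mono s" "\<And>k. \<not> edist_set (u (s k)) (limit_points u) < ereal e"
    using strict_mono_enumerate[OF inf] enumerate_in_set[OF inf] by (auto simp: s_def)
  have "bounded (range (u \<circ> s))" by (rule bounded_subset[OF bdd]) auto
  then obtain w t where t: "strict_mono t" "((u \<circ> s) \<circ> t) \<longlonglongrightarrow> w"
    using bounded_imp_convergent_subsequence by blast
  have "w \<in> limit_points u"
    unfolding limit_points_def using t s(1) strict_mono_o by (metis (mono_tags) comp_assoc mem_Collect_eq)
  then have le: "edist_set v (limit_points u) \<le> ereal (norm (v - w))" for v
    unfolding edist_set_def by (rule INF_lower)
  have "\<forall>\<^sub>F k in sequentially. dist (((u \<circ> s) \<circ> t) k) w < e" using t(2) e by (rule tendstoD)
  then obtain k where "dist (u (s (t k))) w < e"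
    by (auto simp: eventually_sequentially)
  with le[of "u (s (t k))"] s(2)[of "t k"] show False
    by (metis dist_norm ereal_less(2) le_less_trans less_ereal.simps(1))
qed

text \<open>
  Concavity turns the KL inequality into
  \<open>\<sigma> (d (k + 1))\<^sup>2 \<le> C d k (\<psi> (\<rho> k) - \<psi> (\<rho> (k + 1)))\<close>, and the inequality of arithmetic and
  geometric means linearises this into a telescoping bound.
\<close>

lemma KL_summable_steps:
  fixes u D :: "nat \<Rightarrow> 'a::real_inner" and F :: "'a \<Rightarrow> ereal" and \<rho> d :: "nat \<Rightarrow> real"
  assumes KL: "KL_at F \<Omega> w"
    and Fw: "F w = ereal l" and Fu: "\<And>k. F (u k) = ereal (\<rho> k)" and lim: "\<rho> \<longlonglongrightarrow> l"
    and dist: "\<And>e. e > 0 \<Longrightarrow> \<forall>\<^sub>F k in sequentially. edist_set (u k) \<Omega> < ereal e"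
    and d: "\<And>k. 0 \<le> d k" and sigma: "\<sigma> > 0"
    and descent: "\<forall>\<^sub>F k in sequentially. \<rho> (Suc k) + \<sigma> * (d (Suc k))\<^sup>2 \<le> \<rho> k"
    and D: "\<And>k. D k \<in> limiting_subdiff F (u k)" and D_le: "\<And>k. norm (D k) \<le> C * d k"
  shows "summable d"
proof -
  obtain \<epsilon> \<eta> \<psi> where eps: "\<epsilon> > 0" "\<eta> > 0" and psi: "\<psi> \<in> desingularizing \<eta>"
    and KL': "\<And>v. edist_set v \<Omega> < ereal \<epsilon> \<Longrightarrow> F w < F v \<Longrightarrow> F v < F w + ereal \<eta> \<Longrightarrow>
      ereal (deriv \<psi> (real_of_ereal (F v - F w))) * edist_set 0 (limiting_subdiff F v) \<ge> 1"
    using KL unfolding KL_at_def by blast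
  have "\<forall>\<^sub>F k in sequentially. \<rho> k < l + \<eta>"
    using lim eps(2) by (intro order_tendstoD) auto
  with descent dist[OF eps(1)] have "\<forall>\<^sub>F k in sequentially. \<rho> k < l + \<eta> \<and>
      edist_set (u k) \<Omega> < ereal \<epsilon> \<and> \<rho> (Suc k) + \<sigma> * (d (Suc k))\<^sup>2 \<le> \<rho> k"
    by eventually_elim simp
  then obtain K where K: "\<And>k. k \<ge> K \<Longrightarrow> \<rho> k < l + \<eta>" "\<And>k. k \<ge> K \<Longrightarrow> edist_set (u k) \<Omega> < ereal \<epsilon>"
      "\<And>k. k \<ge> K \<Longrightarrow> \<rho> (Suc k) + \<sigma> * (d (Suc k))\<^sup>2 \<le> \<rho> k"
    unfolding eventually_sequentially by blast
  have dec: "\<rho> (Suc k) \<le> \<rho> k" if "k \<ge> K" for k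
    using K(3)[OF that] sigma by (smt (verit) mult_nonneg_nonneg zero_le_power2)
  have ge: "l \<le> \<rho> k" if "k \<ge> K" for k
  proof -
    have "decseq (\<lambda>i. \<rho> (i + K))" by (rule decseq_SucI) (simp add: dec)
    then have "l \<le> \<rho> (k - K + K)" by (rule decseq_ge) (rule LIMSEQ_ignore_initial_segment[OF lim])
    then show ?thesis using that by simp
  qed
  have psi_nonneg: "0 \<le> \<psi> t" if "t \<in> {0..\<eta>}" for t
    using psi that by (auto simp: desingularizing_def)
  define p where "p k = \<psi> (\<rho> k - l)" for k
  have step: "2 * d (Suc k) \<le> d k + C / \<sigma> * p k - C / \<sigma> * p (Suc k)" if k: "k \<ge> K" for k
  proof (cases "\<rho> k = l")
    \<comment> \<open>Here the KL inequality says nothing, but values that have reached their limit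
      stay there, so the descent forces \<open>d (Suc k) = 0\<close>.\<close>
    case True
    then have eq: "\<rho> (Suc k) = l" using dec[OF k] ge[of "Suc k"] k by simp
    then have "\<sigma> * (d (Suc k))\<^sup>2 \<le> 0" using K(3)[OF k] True by simp
    then have "d (Suc k) = 0" using sigma by (simp add: mult_le_0_iff)
    then show ?thesis using eq True d[of k] by (simp add: p_def)
  next
    case False
    define t t' where "t = \<rho> k - l" and "t' = \<rho> (Suc k) - l"
    have t: "0 < t" "t < \<eta>" "0 \<le> t'" "t' \<le> t"
      using False ge[OF k] ge[of "Suc k"] k K(1)[OF k] dec[OF k] by (auto simp: t_def t'_def)
    have pos: "0 < deriv \<psi> t" using psi t by (auto simp: desingularizing_def)
    have diff: "(\<psi> has_real_derivative deriv \<psi> t) (at t)"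
      using psi t by (simp add: desingularizing_def C1_differentiable_on_eq
          DERIV_deriv_iff_real_differentiable)
    \<comment> \<open>The tangent to the concave \<open>\<psi>\<close> at the interior point
      \<open>t\<close> lies above the graph, including at \<open>t' = 0\<close>, where
      \<open>\<psi>\<close> may have no derivative.\<close>
    have "convex_on {0..\<eta>} (\<lambda>s. - \<psi> s)"
      using psi by (simp add: desingularizing_def concave_on_def)
    moreover have "((\<lambda>s. - \<psi> s) has_real_derivative - deriv \<psi> t) (at t within {0..\<eta>})"
      using DERIV_minus[OF diff] by (rule DERIV_subset) simp
    ultimately have "- \<psi> t' - - \<psi> t \<ge> - deriv \<psi> t * (t' - t)"
      using t by (intro convex_on_imp_above_tangent[of "{0..\<eta>}"]) auto
    then have conc: "deriv \<psi> t * (t - t') \<le> p k - p (Suc k)"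
      by (simp add: p_def t_def t'_def algebra_simps)
    \<comment> \<open>As \<open>D k\<close> is a subgradient, its norm bounds the distance from 0 to
      the subdifferential; the KL inequality then makes the slope of \<open>\<psi>\<close> at least
      the reciprocal of \<open>C * d k\<close>.\<close>
    have "ereal (deriv \<psi> t) * edist_set 0 (limiting_subdiff F (u k)) \<ge> 1"
      using KL'[OF K(2)[OF k]] t by (simp add: Fw Fu t_def)
    moreover have "edist_set 0 (limiting_subdiff F (u k)) \<le> ereal (norm (D k))"
      unfolding edist_set_def using INF_lower[OF D[of k], of "\<lambda>s. ereal (norm (0 - s))"] by simp
    ultimately have "1 \<le> ereal (deriv \<psi> t) * ereal (norm (D k))"
      using pos ereal_mult_left_mono[of _ _ "ereal (deriv \<psi> t)"] by (meson ereal_less_eq(5) less_imp_le order_trans)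
    then have "1 \<le> deriv \<psi> t * norm (D k)" by simp
    also have "\<dots> \<le> deriv \<psi> t * (C * d k)" using pos D_le by simp
    finally have one: "1 \<le> deriv \<psi> t * (C * d k)" .
    then have Cd: "0 < C * d k" using pos by (smt (verit) mult_nonneg_nonpos)
    have "\<sigma> * (d (Suc k))\<^sup>2 \<le> t - t'" using K(3)[OF k] by (simp add: t_def t'_def)
    also have "\<dots> \<le> deriv \<psi> t * (C * d k) * (t - t')"
      using mult_right_mono[OF one, of "t - t'"] t by simp
    also have "\<dots> = C * d k * (deriv \<psi> t * (t - t'))" by simp
    also have "\<dots> \<le> C * d k * (p k - p (Suc k))"
      by (rule mult_left_mono[OF conc]) (use Cd in simp)
    finally have *: "(d (Suc k))\<^sup>2 \<le> d k * (C / \<sigma> * (p k - p (Suc k)))"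
      using sigma by (simp add: field_simps)
    have "(2 * d (Suc k))\<^sup>2 \<le> 4 * (d k * (C / \<sigma> * (p k - p (Suc k))))"
      using mult_left_mono[OF *, of 4] by (simp only: power_mult_distrib) simp
    also have "4 * (d k * q) \<le> (d k + q)\<^sup>2" for q
      using zero_le_power2[of "d k - q"] by (simp add: power2_eq_square algebra_simps)
    finally have "(2 * d (Suc k))\<^sup>2 \<le> (d k + C / \<sigma> * (p k - p (Suc k)))\<^sup>2" .
    then have "2 * d (Suc k) \<le> d k + C / \<sigma> * (p k - p (Suc k))" if "0 \<le> C / \<sigma> * (p k - p (Suc k))"
      using that d by (intro power2_le_imp_le[OF _ add_nonneg_nonneg])
    moreover have "0 \<le> C / \<sigma> * (p k - p (Suc k))"
    proof -
      have "C > 0" using Cd d[of k] by (simp add: zero_less_mult_iff)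
      moreover have "0 \<le> deriv \<psi> t * (t - t')" using pos t by simp
      then have "0 \<le> p k - p (Suc k)"
        using conc by linarith
      ultimately show ?thesis using sigma by simp
    qed
    ultimately show ?thesis by (simp add: right_diff_distrib)
  qed
  show ?thesis
  \<comment> \<open>The potential \<open>C / \<sigma> * p\<close> must be nonnegative for the
    telescoping; a negative \<open>C\<close> makes every \<open>d k\<close> zero outright.\<close>
  proof (cases "C \<ge> 0")
    case True
    have "summable (\<lambda>k. d (k + K))"
    proof (rule summable_if_telescoping)
      show "0 \<le> C / \<sigma> * p (k + K)" for k
        unfolding p_def using ge[of "k + K"] K(1)[of "k + K"] True sigma
        by (intro mult_nonneg_nonneg psi_nonneg) auto
      show "2 * d (Suc k + K) \<le> d (k + K) + C / \<sigma> * p (k + K) - C / \<sigma> * p (Suc k + K)" for k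
        using step[of "k + K"] by simp
    qed (rule d)
    then show ?thesis by (simp add: summable_iff_shift)
  next
    case False
    then have "d k = 0" for k
      using D_le[of k] d[of k] by (smt (verit) mult_neg_pos norm_ge_zero)
    then have "d = (\<lambda>_. 0)" by auto
    then show ?thesis by simp
  qed
qed

section \<open>Lower semicontinuity along sequences\<close>

lemma lower_semicontinuous_eventually_greater:
  assumes "lower_semicontinuous F" "b < F x" "X \<longlonglongrightarrow> x"
  shows "\<forall>\<^sub>F k in sequentially. b < F (X k)"
proof -
  have "F x \<le> Liminf (at x) F" using assms(1) by (simp add: lower_semicontinuous_def)
  with assms(2) have "\<forall>\<^sub>F w in at x. b < F w" by (simp add: le_Liminf_iff)
  \<comment> \<open>The punctured neighbourhood omits \<open>x\<close> itself, which the sequence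
    may visit; there \<open>b < F x\<close> serves.\<close>
  with assms(2) have "\<forall>\<^sub>F w in nhds x. b < F w" by (auto simp: eventually_at_filter elim: eventually_mono)
  then show ?thesis using assms(3) by (rule eventually_compose_filterlim)
qed

text \<open>Semicontinuity controls the values from below, the hypothesis with \<open>e\<close> from
  above. Minimality in the x-update will supply such an \<open>e\<close>; this is how the values of
  a possibly discontinuous \<open>f\<close> are shown to converge.\<close>

lemma lower_semicontinuous_tendsto:
  assumes lsc: "lower_semicontinuous F" and X: "X \<longlonglongrightarrow> x"
    and le: "\<And>k. F (X k) \<le> F x + ereal (e k)" and e: "e \<longlonglongrightarrow> 0"
  shows "(\<lambda>k. F (X k)) \<longlonglongrightarrow> F x"
proof (rule order_tendstoI)
  fix b assume "b < F x"
  then show "\<forall>\<^sub>F k in sequentially. b < F (X k)"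
    using lower_semicontinuous_eventually_greater[OF lsc _ X] by blast
next
  fix b assume b: "F x < b"
  have "(\<lambda>k. F x + ereal (e k)) \<longlonglongrightarrow> F x"
  proof (cases "F x")
    case (real t)
    have "(\<lambda>k. t + e k) \<longlonglongrightarrow> t + 0" by (intro tendsto_intros e)
    then show ?thesis by (simp add: real)
  qed (auto simp: tendsto_const)
  then have "\<forall>\<^sub>F k in sequentially. F x + ereal (e k) < b" using b by (rule order_tendstoD)
  then show "\<forall>\<^sub>F k in sequentially. F (X k) < b"
    by eventually_elim (use le in \<open>blast intro: le_less_trans\<close>)
qed

section \<open>Matrix estimates and bounds linear in the step length\<close>

lemma norm_mat_vec_le: "norm (M *v v) \<le> opnorm M * norm v"
  by (rule onorm) (rule matrix_vector_mul_bounded_linear)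

lemma tendsto_mat_vec:
  fixes M :: "real^'n^'m"
  shows "(X \<longlongrightarrow> w) S \<Longrightarrow> ((\<lambda>k. M *v X k) \<longlongrightarrow> M *v w) S"
  by (rule bounded_linear.tendsto[OF matrix_vector_mul_bounded_linear])

text \<open>For the proximal terms: their matrices may vary without converging, but a common bound
  on the operator norms is available.\<close>

lemma tendsto_bounded_mat_vec_zero:
  fixes Q :: "nat \<Rightarrow> real^'n^'m"
  assumes "bdd_above (range (\<lambda>k. opnorm (Q k)))" "X \<longlonglongrightarrow> 0"
  shows "(\<lambda>k. Q k *v X k) \<longlonglongrightarrow> 0"
proof -
  obtain q where q: "\<And>k. opnorm (Q k) \<le> q" using assms(1) by (auto simp: bdd_above_def)
  have "norm (Q k *v X k) \<le> norm (X k) * q" for k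
    using norm_mat_vec_le[of "Q k" "X k"] mult_right_mono[OF q[of k] norm_ge_zero[of "X k"]]
    by (simp add: mult.commute)
  then show ?thesis by (intro tendsto_0_le[OF assms(2)] always_eventually allI)
qed

text \<open>An O(\<open>d k\<close>) bound valid at every index. The constant stays existential, so
  that long sums are bounded by introduction rules alone.\<close>

definition lin_bounded :: "(nat \<Rightarrow> real) \<Rightarrow> (nat \<Rightarrow> 'a::real_normed_vector) \<Rightarrow> bool" where
  "lin_bounded d v \<longleftrightarrow> (\<exists>C. \<forall>k. norm (v k) \<le> C * d k)"

lemma lin_boundedI: "(\<And>k. norm (v k) \<le> C * d k) \<Longrightarrow> lin_bounded d v"
  by (auto simp: lin_bounded_def)

lemma lin_bounded_add: "lin_bounded d v \<Longrightarrow> lin_bounded d w \<Longrightarrow> lin_bounded d (\<lambda>k. v k + w k)"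
proof -
  assume "lin_bounded d v" "lin_bounded d w"
  then obtain C E where "\<And>k. norm (v k) \<le> C * d k" "\<And>k. norm (w k) \<le> E * d k"
    unfolding lin_bounded_def by blast
  then have "norm (v k + w k) \<le> (C + E) * d k" for k
    by (simp add: distrib_right norm_triangle_mono)
  then show ?thesis by (rule lin_boundedI)
qed

lemma lin_bounded_trans:
  assumes "lin_bounded d v" "\<And>k. norm (w k) \<le> q * norm (v k)" "0 \<le> q"
  shows "lin_bounded d w"
proof -
  obtain C where "\<And>k. norm (v k) \<le> C * d k" using assms(1) by (auto simp: lin_bounded_def)
  then have "norm (w k) \<le> (q * C) * d k" for k
    by (simp add: mult.assoc order_trans[OF assms(2)] mult_left_mono assms(3))
  then show ?thesis by (rule lin_boundedI)
qed

lemma lin_bounded_scaleR: "lin_bounded d v \<Longrightarrow> lin_bounded d (\<lambda>k. a *\<^sub>R v k)"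
  by (erule lin_bounded_trans[where q = "\<bar>a\<bar>"]) auto

lemma lin_bounded_mat_vec:
  fixes M :: "real^'n^'m"
  shows "lin_bounded d v \<Longrightarrow> lin_bounded d (\<lambda>k. M *v v k)"
  by (erule lin_bounded_trans[where q = "opnorm M"])
    (auto intro: norm_mat_vec_le onorm_pos_le matrix_vector_mul_bounded_linear)

lemma lin_bounded_bdd_mat_vec:
  assumes v: "lin_bounded d v" and Q: "bdd_above (range (\<lambda>k. opnorm (Q k)))"
  shows "lin_bounded d (\<lambda>k. Q k *v v k)"
proof -
  obtain q where q: "\<And>k. opnorm (Q k) \<le> q" using Q by (auto simp: bdd_above_def)
  have "norm (Q k *v v k) \<le> q * norm (v k)" for k
    using norm_mat_vec_le[of "Q k" "v k"] mult_right_mono[OF q[of k] norm_ge_zero[of "v k"]] by simp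
  moreover have "0 \<le> q"
    using onorm_pos_le[OF matrix_vector_mul_bounded_linear, of "Q 0"] q[of 0] by simp
  ultimately show ?thesis by (rule lin_bounded_trans[OF v])
qed

lemma lin_bounded_Pair:
  assumes "lin_bounded d v" "lin_bounded d w"
  shows "lin_bounded d (\<lambda>k. (v k, w k))"
proof -
  obtain C E where "\<And>k. norm (v k) \<le> C * d k" "\<And>k. norm (w k) \<le> E * d k"
    using assms unfolding lin_bounded_def by blast
  then have "norm (v k, w k) \<le> (C + E) * d k" for k
    by (simp add: distrib_right order_trans[OF norm_Pair_le] add_mono)
  then show ?thesis by (rule lin_boundedI)
qed

lemma continuous_coupling:
  assumes "GDERIV g x :> Gx" "GDERIV h y :> Hy"
  shows "isCont (coupling g h A B c \<alpha> a b) (x, y, z, y', z')"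
  using gderiv_coupling[OF assms] unfolding gderiv_def by (rule has_derivative_continuous)

section \<open>Optimality conditions of the two subproblems\<close>

lemma prox_step:
  fixes f :: "real^'n \<Rightarrow> ereal"
  assumes f: "proper f" and Q: "sym_psd Q"
    and min: "is_arg_min (\<lambda>w. f w + ereal (p \<bullet> (w - x) + 1 / 2 * sqnorm Q (w - x))) (\<lambda>_. True) x'"
  shows "\<bar>f x'\<bar> \<noteq> \<infinity>"
    and "- (p + Q *v (x' - x)) \<in> frechet_subdiff f x'"
    and "f x' \<le> f w + ereal (p \<bullet> (w - x') + 1 / 2 * ((w - x) \<bullet> (Q *v (w - x))))"
proof -
  define \<phi> where "\<phi> w = p \<bullet> (w - x) + 1 / 2 * sqnorm Q (w - x)" for w
  have min': "f x' + ereal (\<phi> x') \<le> f w + ereal (\<phi> w)" for w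
    using min by (auto simp: is_arg_min_linorder \<phi>_def)
  \<comment> \<open>Properness supplies a competitor of finite value, which keeps the minimal value
    below \<infinity>.\<close>
  obtain v where v: "f v \<noteq> \<infinity>" "f v \<noteq> - \<infinity>" using f by (auto simp: proper_def)
  have "f x' \<noteq> - \<infinity>" using f by (simp add: proper_def)
  then show fin: "\<bar>f x'\<bar> \<noteq> \<infinity>"
    using min'[of v] v by auto
  have "GDERIV \<phi> x' :> p + Q *v (x' - x)"
    unfolding \<phi>_def by (rule gderiv_linear_half_sqnorm) (use Q in \<open>simp add: sym_psd_def\<close>)
  with fin min' show "- (p + Q *v (x' - x)) \<in> frechet_subdiff f x'"
    by (rule frechet_subdiff_if_minimizer)
  \<comment> \<open>Semidefiniteness lets the quadratic term at the new point be dropped from the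
    comparison with \<open>w\<close>.\<close>
  have "0 \<le> sqnorm Q (x' - x)" using Q by (simp add: sym_psd_def sqnorm_def)
  then have "\<phi> w - \<phi> x' \<le> p \<bullet> (w - x') + 1 / 2 * ((w - x) \<bullet> (Q *v (w - x)))"
    by (simp add: \<phi>_def sqnorm_def inner_diff_right)
  then show "f x' \<le> f w + ereal (p \<bullet> (w - x') + 1 / 2 * ((w - x) \<bullet> (Q *v (w - x))))"
    using min'[of w] fin by (cases "f x'"; cases "f w") auto
qed

text \<open>The objective of the y-update is differentiable, so its gradient vanishes at the
  minimizer. In the application \<open>a\<close> is \<open>A *v x (Suc k)\<close>.\<close>

lemma prox_linear_quadratic_step:
  fixes B :: "real^'m^'p"
  assumes Q: "sym_psd Q"
    and min: "is_arg_min (\<lambda>w. p \<bullet> (w - y) + \<alpha> / 2 * (norm (B *v w + a + c))\<^sup>2 + 1 / 2 * sqnorm Q (w - y))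
        (\<lambda>_. True) y'"
  shows "p + \<alpha> *\<^sub>R (transpose B *v (a + B *v y' + c)) + Q *v (y' - y) = 0"
proof -
  define \<phi> where "\<phi> w = (p \<bullet> (w - y) + 1 / 2 * sqnorm Q (w - y)) + \<alpha> / 2 * (norm (B *v w + (a + c)))\<^sup>2" for w
  have "\<phi> y' \<le> \<phi> w" for w
    using min by (auto simp: is_arg_min_linorder \<phi>_def add_ac)
  moreover have "GDERIV \<phi> y' :> (p + Q *v (y' - y)) + \<alpha> *\<^sub>R (transpose B *v (B *v y' + (a + c)))"
    unfolding \<phi>_def
    by (intro GDERIV_add gderiv_linear_half_sqnorm gderiv_half_norm_sq_affine) (use Q in \<open>simp add: sym_psd_def\<close>)
  ultimately have "(\<lambda>h. h \<bullet> ((p + Q *v (y' - y)) + \<alpha> *\<^sub>R (transpose B *v (B *v y' + (a + c))))) = (\<lambda>h. 0)"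
    unfolding gderiv_def by (intro differential_zero_maxmin[of y' UNIV \<phi>]) auto
  then have "(p + Q *v (y' - y)) + \<alpha> *\<^sub>R (transpose B *v (B *v y' + (a + c))) = 0"
    by (metis inner_eq_zero_iff)
  moreover have "B *v y' + (a + c) = a + B *v y' + c" by simp
  ultimately show ?thesis by (simp only: add_ac)
qed

lemma convergent_if_summable_steps:
  fixes u :: "nat \<Rightarrow> 'a::banach"
  assumes "summable (\<lambda>k. norm (u (Suc k) - u k))"
  shows "convergent u"
proof -
  have "summable (\<lambda>k. u (Suc k) - u k)" using assms by (rule summable_norm_cancel)
  then have "(\<lambda>n. \<Sum>k<n. u (Suc k) - u k) \<longlonglongrightarrow> suminf (\<lambda>k. u (Suc k) - u k)"
    by (rule summable_LIMSEQ)
  then have "(\<lambda>n. (\<Sum>k<n. u (Suc k) - u k) + u 0) \<longlonglongrightarrow> suminf (\<lambda>k. u (Suc k) - u k) + u 0"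
    by (intro tendsto_intros)
  then show ?thesis by (auto simp: sum_lessThan_telescope convergent_def)
qed

theorem theorem2:
  fixes A :: "real^'n^'p" and B :: "real^'m^'p" and c :: "real^'p"
    and f :: "real^'n \<Rightarrow> ereal" and g :: "real^'n \<Rightarrow> real" and h :: "real^'m \<Rightarrow> real"
    and G :: "real^'n \<Rightarrow> real^'n" and H :: "real^'m \<Rightarrow> real^'m"
    and L\<^sub>g L\<^sub>h \<alpha> \<beta> r \<sigma> q\<^sub>2 :: real
    and Q\<^sub>1 :: "nat \<Rightarrow> real^'n^'n" and Q\<^sub>2 :: "nat \<Rightarrow> real^'m^'m"
    and x :: "nat \<Rightarrow> real^'n" and y :: "nat \<Rightarrow> real^'m" and z :: "nat \<Rightarrow> real^'p"
    and k\<^sub>0 :: nat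
    and R :: "(real^'n) \<times> (real^'m) \<times> (real^'p) \<times> (real^'m) \<times> (real^'p) \<Rightarrow> ereal"
    and \<Omega> :: "((real^'n) \<times> (real^'m) \<times> (real^'p) \<times> (real^'m) \<times> (real^'p)) set"
  assumes f_proper: "proper f"
    and g_grad: "\<forall>w. GDERIV g w :> G w"
    and h_grad: "\<forall>w. GDERIV h w :> H w"
    and A1: "lower_semicontinuous f" "(f \<longlongrightarrow> \<infinity>) at_infinity"
    and A2: "filterlim g at_top at_infinity" "bdd_below (range h)"
    and A3: "rank B = CARD('m)" "range ((*v) A) \<subseteq> range ((*v) B)" "c \<in> range ((*v) B)"
    and A4: "L\<^sub>g-lipschitz_on UNIV G" "L\<^sub>h-lipschitz_on UNIV H"
    and A5: "\<alpha> > 0" "0 < \<beta>" "\<beta> < 2"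
      "(INF k. opnorm (Q\<^sub>1 k)) \<ge> 0" "(INF k. opnorm (Q\<^sub>2 k)) \<ge> 0"
      "bdd_above (range (\<lambda>k. opnorm (Q\<^sub>1 k)))" "bdd_above (range (\<lambda>k. opnorm (Q\<^sub>2 k)))"
    and q2_eq: "q\<^sub>2 = (SUP k. opnorm (Q\<^sub>2 k))"
    and R_eq: "R = reg_lagrangian f g h A B c \<alpha> \<beta> r L\<^sub>h q\<^sub>2"
    and r: "r > 1"
    and k0: "k\<^sub>0 \<ge> 1"
    and sigma: "\<sigma> > 0"
    and params: "(INF k\<in>{k\<^sub>0..}. Min
        {opnorm (Q\<^sub>1 k) - \<alpha> * lambda_max (transpose A ** A) - L\<^sub>g,
         opnorm (Q\<^sub>2 k) + \<alpha> * lambda_pos (transpose B ** B)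
           - (L\<^sub>h + r * theta0 B \<alpha> \<beta> L\<^sub>h q\<^sub>2 + r * theta1 B \<alpha> \<beta> q\<^sub>2),
         (r - 1) / (\<alpha> * \<beta>)}) > \<sigma>"
    and descent: "\<forall>k\<ge>k\<^sub>0.
        R (ext_iterate x y z (Suc k)) +
          ereal (\<sigma> * ((norm (x (Suc k) - x k))\<^sup>2 + (norm (y (Suc k) - y k))\<^sup>2
                     + (norm (z (Suc k) - z k))\<^sup>2))
          \<le> R (ext_iterate x y z k) \<and>
        R (ext_iterate x y z k) \<le> R (ext_iterate x y z k\<^sub>0)"
    and generated: "PL_ADMM f G H A B c \<alpha> \<beta> Q\<^sub>1 Q\<^sub>2 x y z"
    and bdd: "bounded (range (\<lambda>k. (x k, y k, z k)))"
    and Omega_eq: "\<Omega> = limit_points (\<lambda>j. ext_iterate x y z (Suc j))"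
    and KL: "\<forall>x' y' z'. (x', y', z', y', z') \<in> \<Omega> \<longrightarrow> KL_at R \<Omega> (x', y', z', y', z')"
  shows "summable (\<lambda>k. norm (x (Suc k) - x k) + norm (y (Suc k) - y k) + norm (z (Suc k) - z k)) \<and>
    (\<exists>x' y' z'. x \<longlonglongrightarrow> x' \<and> y \<longlonglongrightarrow> y' \<and> z \<longlonglongrightarrow> z' \<and> stationary_point f G H A B c x' y' z')"
proof -

  \<comment> \<open>The function \<open>R\<close> as \<open>f\<close> plus a smooth term, and the
    indexing of the iterates\<close>
  define a b where "a = r * gamma0 B \<alpha> \<beta>" and "b = r * theta0 B \<alpha> \<beta> L\<^sub>h q\<^sub>2"
  define S where "S = coupling g h A B c \<alpha> a b"
  have R: "R = (\<lambda>v. f (fst v) + ereal (S v))"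
    by (rule ext) (simp add: R_eq reg_lagrangian_eq_coupling S_def a_def b_def)
  \<comment> \<open>\<open>U k\<close> is the extended iterate of index \<open>Suc k\<close>: the
    shift avoids index 0, where the predecessor would be 0 again. Accordingly \<open>d k\<close> is
    the length of the step that leads into \<open>U k\<close>.\<close>
  define U where "U k = (x (Suc k), y (Suc k), z (Suc k), y k, z k)" for k
  have ext_U: "ext_iterate x y z (Suc k) = U k" for k by (simp add: ext_iterate_def U_def)
  have Omega: "\<Omega> = limit_points U" by (simp add: Omega_eq ext_U)
  define d where "d k = norm (x (Suc k) - x k) + norm (y (Suc k) - y k) + norm (z (Suc k) - z k)" for k
  have d_nonneg: "0 \<le> d k" for k by (simp add: d_def)
  define res where "res k = A *v x (Suc k) + B *v y (Suc k) + c" for k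
  define p where "p k = G (x k) + \<alpha> *\<^sub>R (transpose A *v (A *v x k + B *v y k + c + (1 / \<alpha>) *\<^sub>R z k))" for k
  define \<xi> where "\<xi> k = - (p k + Q\<^sub>1 k *v (x (Suc k) - x k))" for k

  \<comment> \<open>Optimality conditions along the iterates\<close>
  have gen: "sym_psd (Q\<^sub>1 k)" "sym_psd (Q\<^sub>2 k)"
    "is_arg_min (\<lambda>w. f w + ereal (p k \<bullet> (w - x k) + 1 / 2 * sqnorm (Q\<^sub>1 k) (w - x k))) (\<lambda>_. True) (x (Suc k))"
    "is_arg_min (\<lambda>w. (H (y k) + transpose B *v z k) \<bullet> (w - y k)
             + \<alpha> / 2 * (norm (B *v w + A *v x (Suc k) + c))\<^sup>2
             + 1 / 2 * sqnorm (Q\<^sub>2 k) (w - y k)) (\<lambda>_. True) (y (Suc k))"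
    "z (Suc k) = z k + (\<alpha> * \<beta>) *\<^sub>R res k" for k
    using generated unfolding PL_ADMM_def p_def res_def by blast+
  note x_step = prox_step[OF f_proper gen(1) gen(3), folded \<xi>_def]
  have y_step: "H (y k) + transpose B *v z k + \<alpha> *\<^sub>R (transpose B *v res k) + Q\<^sub>2 k *v (y (Suc k) - y k) = 0" for k
    using prox_linear_quadratic_step[OF gen(2) gen(4)] by (simp add: res_def)
  \<comment> \<open>The multiplier update read backwards: the residual is a multiple of the step of
    \<open>z\<close>.\<close>
  have res_eq: "res k = (1 / (\<alpha> * \<beta>)) *\<^sub>R (z (Suc k) - z k)" for k
    using A5 by (simp add: gen(5))

  have S_cont: "isCont S v" for v
    unfolding S_def by (cases v) (use continuous_coupling g_grad h_grad in blast)
  have G_cont: "isCont G w" and H_cont: "isCont H v" for w v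
    using A4[THEN lipschitz_on_continuous_on] by (auto simp: continuous_on_eq_continuous_at)

  \<comment> \<open>A subgradient of \<open>R\<close> at each iterate, bounded by the step
    length\<close>
  define D where "D k =
    (\<xi> k + (G (x (Suc k)) + transpose A *v z (Suc k) + \<alpha> *\<^sub>R (transpose A *v res k)),
     H (y (Suc k)) + transpose B *v z (Suc k) + \<alpha> *\<^sub>R (transpose B *v res k) + (2 * b) *\<^sub>R (y (Suc k) - y k),
     res k + (2 * a) *\<^sub>R (B *v (transpose B *v (z (Suc k) - z k))),
     - (2 * b) *\<^sub>R (y (Suc k) - y k),
     - (2 * a) *\<^sub>R (B *v (transpose B *v (z (Suc k) - z k))))" for k
  have D: "D k \<in> limiting_subdiff R (U k)" for k
  proof -
    \<comment> \<open>The sum rule: \<open>\<xi> k\<close> in the first block, plus the gradient of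
      \<open>S\<close> at \<open>U k\<close>.\<close>
    have "(\<xi> k, 0) \<in> frechet_subdiff (\<lambda>v. f (fst v)) (U k)"
      unfolding U_def using x_step(2) by (rule frechet_subdiff_comp_fst)
    from frechet_subdiff_add_smooth[OF this[unfolded U_def] gderiv_coupling, OF g_grad[rule_format] h_grad[rule_format]]
    have "D k \<in> frechet_subdiff R (U k)"
      by (simp add: R S_def U_def D_def res_def)
    then show ?thesis using frechet_subdiff_subset_limiting by blast
  qed

  have "lin_bounded d D"
  proof -
    have lx: "lin_bounded d (\<lambda>k. x (Suc k) - x k)"
      and ly: "lin_bounded d (\<lambda>k. y (Suc k) - y k)"
      and lz: "lin_bounded d (\<lambda>k. z (Suc k) - z k)"
      by (rule lin_boundedI[where C = 1]; simp add: d_def)+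
    have lG: "lin_bounded d (\<lambda>k. G (x (Suc k)) - G (x k))"
      using lipschitz_onD[OF A4(1)] lipschitz_on_nonneg[OF A4(1)]
      by (intro lin_bounded_trans[OF lx]) (auto simp: dist_norm)
    have lH: "lin_bounded d (\<lambda>k. H (y (Suc k)) - H (y k))"
      using lipschitz_onD[OF A4(2)] lipschitz_on_nonneg[OF A4(2)]
      by (intro lin_bounded_trans[OF ly]) (auto simp: dist_norm)
    \<comment> \<open>The gradient of \<open>S\<close> is taken at the new iterate, the optimality
      conditions involve the old one. After cancellation only differences of consecutive iterates,
      or of gradients at them, remain, and each is controlled by one step.\<close>
    have D_eq: "D k =
      ((G (x (Suc k)) - G (x k)) + transpose A *v (z (Suc k) - z k)
         + \<alpha> *\<^sub>R (transpose A *v (A *v (x (Suc k) - x k) + B *v (y (Suc k) - y k)))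
         + (- 1) *\<^sub>R (Q\<^sub>1 k *v (x (Suc k) - x k)),
       (H (y (Suc k)) - H (y k)) + transpose B *v (z (Suc k) - z k)
         + (2 * b) *\<^sub>R (y (Suc k) - y k) + (- 1) *\<^sub>R (Q\<^sub>2 k *v (y (Suc k) - y k)),
       (1 / (\<alpha> * \<beta>)) *\<^sub>R (z (Suc k) - z k) + (2 * a) *\<^sub>R (B *v (transpose B *v (z (Suc k) - z k))),
       (- (2 * b)) *\<^sub>R (y (Suc k) - y k),
       (- (2 * a)) *\<^sub>R (B *v (transpose B *v (z (Suc k) - z k))))" for k
    proof -
      have 1: "p k = G (x k) + \<alpha> *\<^sub>R (transpose A *v (A *v x k + B *v y k + c)) + transpose A *v z k"
        using A5 by (simp add: p_def matrix_vector_right_distrib matrix_vector_mult_scaleR scaleR_right_distrib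
            del: transpose_matrix_vector)
      have 2: "res k = (A *v x k + B *v y k + c) + (A *v (x (Suc k) - x k) + B *v (y (Suc k) - y k))"
        by (simp add: res_def matrix_vector_mult_diff_distrib)
      have 3: "transpose M *v z (Suc k) = transpose M *v z k + transpose M *v (z (Suc k) - z k)" for M :: "real^'q^'p"
        by (simp add: matrix_vector_mult_diff_distrib del: transpose_matrix_vector)
      have "\<xi> k + (G (x (Suc k)) + transpose A *v z (Suc k) + \<alpha> *\<^sub>R (transpose A *v res k)) =
        (G (x (Suc k)) - G (x k)) + transpose A *v (z (Suc k) - z k)
         + \<alpha> *\<^sub>R (transpose A *v (A *v (x (Suc k) - x k) + B *v (y (Suc k) - y k)))
         + (- 1) *\<^sub>R (Q\<^sub>1 k *v (x (Suc k) - x k))"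
        unfolding \<xi>_def 1 2 3[of A] matrix_vector_right_distrib[of "transpose A" "A *v x k + B *v y k + c"] scaleR_right_distrib
        by simp
      moreover have "H (y (Suc k)) + transpose B *v z (Suc k) + \<alpha> *\<^sub>R (transpose B *v res k) =
        (H (y (Suc k)) - H (y k)) + transpose B *v (z (Suc k) - z k) + (- 1) *\<^sub>R (Q\<^sub>2 k *v (y (Suc k) - y k))"
        using y_step[of k] unfolding 3[of B] by (simp add: add_eq_0_iff algebra_simps del: transpose_matrix_vector)
      ultimately show ?thesis by (simp add: D_def res_eq[symmetric])
    qed
    show ?thesis
      unfolding D_eq
      by (intro lin_bounded_Pair lin_bounded_add lin_bounded_scaleR lin_bounded_mat_vec
          lin_bounded_bdd_mat_vec A5(6,7) lx ly lz lG lH)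
  qed
  then obtain C where D_le: "\<And>k. norm (D k) \<le> C * d k" by (auto simp: lin_bounded_def)

  \<comment> \<open>Boundedness, descent and convergence of the values of \<open>R\<close>\<close>
  have U_bdd: "bounded (range U)"
  proof -
    obtain N where N: "\<And>k. norm (x k, y k, z k) \<le> N" using bdd by (auto simp: bounded_iff)
    have "norm (x k) \<le> N" "norm (y k) \<le> N" "norm (z k) \<le> N" for k
      using N[of k] norm_fst_le[of "x k" "(y k, z k)"] norm_snd_le[of "(y k, z k)" "x k"]
        norm_fst_le[of "y k" "z k"] norm_snd_le[of "z k" "y k"] by auto
    then have "norm (U k) \<le> N + (N + (N + (N + N)))" for k
      unfolding U_def by (intro order_trans[OF norm_Pair_le] add_mono) auto
    then show ?thesis by (auto simp: bounded_iff)
  qed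

  \<comment> \<open>From index 1 on every \<open>x\<close>-iterate is a minimizer with finite
    \<open>f\<close>, so \<open>real_of_ereal\<close> loses nothing.\<close>
  define \<rho> where "\<rho> k = real_of_ereal (f (x (Suc k))) + S (U k)" for k
  have f_eq: "f (x (Suc k)) = ereal (\<rho> k - S (U k))" for k
    using x_step(1)[of k] by (simp add: \<rho>_def ereal_real)
  have RU: "R (U k) = ereal (\<rho> k)" for k
    using f_eq[of k] by (simp add: R U_def)
  \<comment> \<open>The given descent has a sum of squares, \<open>d\<close> is a sum of norms;
    passing from one to the other costs the factor 3.\<close>
  have desc: "\<rho> (Suc k) + \<sigma> / 3 * (d (Suc k))\<^sup>2 \<le> \<rho> k" if "k \<ge> k\<^sub>0" for k
  proof -
    let ?e = "(norm (x (Suc (Suc k)) - x (Suc k)))\<^sup>2 + (norm (y (Suc (Suc k)) - y (Suc k)))\<^sup>2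
                     + (norm (z (Suc (Suc k)) - z (Suc k)))\<^sup>2"
    have "\<rho> (Suc k) + \<sigma> * ?e \<le> \<rho> k"
      using descent[rule_format, of "Suc k"] that by (simp add: ext_U RU)
    moreover have "(u + v + w)\<^sup>2 \<le> 3 * (u\<^sup>2 + v\<^sup>2 + w\<^sup>2)" for u v w :: real
      using zero_le_power2[of "u - v"] zero_le_power2[of "u - w"] zero_le_power2[of "v - w"]
      by (simp add: power2_eq_square algebra_simps)
    then have "\<sigma> / 3 * (d (Suc k))\<^sup>2 \<le> \<sigma> / 3 * (3 * ?e)"
      unfolding d_def using sigma by (intro mult_left_mono) auto
    then have "\<sigma> / 3 * (d (Suc k))\<^sup>2 \<le> \<sigma> * ?e" by (simp only: mult.assoc[symmetric])
    ultimately show ?thesis by linarith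
  qed
  have \<rho>_antimono: "\<rho> n \<le> \<rho> m" if "k\<^sub>0 \<le> m" "m \<le> n" for m n
    using that(2)
  proof (induction rule: dec_induct)
    case (step i)
    moreover have "0 \<le> \<sigma> / 3 * (d (Suc i))\<^sup>2" using sigma by simp
    ultimately show ?case using desc[of i] that(1) by simp
  qed simp

  obtain w s where s: "strict_mono s" "(U \<circ> s) \<longlonglongrightarrow> w"
    using bounded_imp_convergent_subsequence[OF U_bdd] by blast
  \<comment> \<open>Along the subsequence tending to \<open>w\<close>, semicontinuity keeps
    \<open>f\<close> above the real number \<open>t\<close> and continuity keeps \<open>S\<close>
    above \<open>S w - 1\<close>. Monotonicity from \<open>k\<^sub>0\<close> on carries this lower
    bound over to all later values, because every index is followed by one of the
    subsequence.\<close>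
  obtain l where l: "\<rho> \<longlonglongrightarrow> l"
  proof -
    have "f (fst w) \<noteq> - \<infinity>" using f_proper by (simp add: proper_def)
    then obtain t where t: "ereal t < f (fst w)" using ereal_dense2[of "- \<infinity>" "f (fst w)"] by auto
    have "(\<lambda>j. x (Suc (s j))) \<longlonglongrightarrow> fst w"
      using tendsto_fst[OF s(2)] by (simp add: U_def o_def)
    from lower_semicontinuous_eventually_greater[OF A1(1) t this]
    have "\<forall>\<^sub>F j in sequentially. ereal t < f (x (Suc (s j)))" .
    moreover have "(\<lambda>j. S (U (s j))) \<longlonglongrightarrow> S w"
      using isCont_tendsto_compose[OF S_cont s(2)] by (simp add: o_def)
    then have "\<forall>\<^sub>F j in sequentially. S w - 1 < S (U (s j))" by (rule order_tendstoD) simp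
    ultimately have ev: "\<forall>\<^sub>F j in sequentially. t + (S w - 1) \<le> \<rho> (s j)"
      by eventually_elim (simp add: f_eq)
    have low: "t + (S w - 1) \<le> \<rho> (i + k\<^sub>0)" for i
    proof -
      obtain j where "j \<ge> i + k\<^sub>0" "t + (S w - 1) \<le> \<rho> (s j)"
        using ev unfolding eventually_sequentially by (meson nle_le)
      moreover have "i + k\<^sub>0 \<le> s j" using seq_suble[OF s(1), of j] \<open>j \<ge> i + k\<^sub>0\<close> by simp
      ultimately show ?thesis using \<rho>_antimono[of "i + k\<^sub>0" "s j"] by simp
    qed
    have dec: "decseq (\<lambda>i. \<rho> (i + k\<^sub>0))" by (rule decseq_SucI) (simp add: \<rho>_antimono)
    obtain L where "(\<lambda>i. \<rho> (i + k\<^sub>0)) \<longlonglongrightarrow> L"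
      by (rule decseq_convergent[OF dec allI[OF low]])
    then have "\<rho> \<longlonglongrightarrow> L" by (rule LIMSEQ_offset)
    then show ?thesis by (rule that)
  qed

  \<comment> \<open>Vanishing steps and the structure of the limit points\<close>
  have d_lim: "d \<longlonglongrightarrow> 0"
  proof -
    have "(\<lambda>k. 3 / \<sigma> * (\<rho> k - \<rho> (Suc k))) \<longlonglongrightarrow> 3 / \<sigma> * (l - l)"
      by (intro tendsto_intros l LIMSEQ_Suc)
    then have lim0: "(\<lambda>k. 3 / \<sigma> * (\<rho> k - \<rho> (Suc k))) \<longlonglongrightarrow> 0" by simp
    have le: "\<forall>\<^sub>F k in sequentially. (d (Suc k))\<^sup>2 \<le> 3 / \<sigma> * (\<rho> k - \<rho> (Suc k))"
      using eventually_ge_at_top[of k\<^sub>0]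
    proof eventually_elim
      case (elim k)
      then show ?case using desc[OF elim] sigma by (simp add: field_simps)
    qed
    have "(\<lambda>k. (d (Suc k))\<^sup>2) \<longlonglongrightarrow> 0"
      by (rule tendsto_sandwich[OF _ le tendsto_const lim0]) simp
    then have "(\<lambda>k. d (Suc k)) \<longlonglongrightarrow> 0" by simp
    then show ?thesis by (rule LIMSEQ_imp_Suc)
  qed
  have dx: "(\<lambda>k. x (Suc k) - x k) \<longlonglongrightarrow> 0" and dy: "(\<lambda>k. y (Suc k) - y k) \<longlonglongrightarrow> 0"
    and dz: "(\<lambda>k. z (Suc k) - z k) \<longlonglongrightarrow> 0"
    by (rule Lim_null_comparison[OF _ d_lim], simp add: d_def)+

  \<comment> \<open>Vanishing steps identify the old and new \<open>y\<close> and \<open>z\<close>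
    parts of a limit point, which is the diagonal form in which KL is assumed. The value
    \<open>l\<close> of \<open>R\<close> does not depend on the subsequence.\<close>
  have limit: "ys' = ys \<and> zs' = zs \<and> (\<lambda>j. f (x (Suc (s j)))) \<longlonglongrightarrow> f xs \<and> R (xs, ys, zs, ys', zs') = ereal l"
    if s: "strict_mono s" and lim: "(U \<circ> s) \<longlonglongrightarrow> (xs, ys, zs, ys', zs')" for s xs ys zs ys' zs'
  proof -
    have sub: "(\<lambda>j. v (s j)) \<longlonglongrightarrow> t" if "v \<longlonglongrightarrow> t" for v :: "nat \<Rightarrow> 'q::topological_space" and t
      using LIMSEQ_subseq_LIMSEQ[OF that s] by (simp add: o_def)
    have lim': "(\<lambda>j. x (Suc (s j))) \<longlonglongrightarrow> xs" "(\<lambda>j. y (Suc (s j))) \<longlonglongrightarrow> ys" "(\<lambda>j. z (Suc (s j))) \<longlonglongrightarrow> zs"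
      "(\<lambda>j. y (s j)) \<longlonglongrightarrow> ys'" "(\<lambda>j. z (s j)) \<longlonglongrightarrow> zs'"
      using lim[THEN tendsto_fst] lim[THEN tendsto_snd, THEN tendsto_fst]
        lim[THEN tendsto_snd, THEN tendsto_snd, THEN tendsto_fst]
        lim[THEN tendsto_snd, THEN tendsto_snd, THEN tendsto_snd, THEN tendsto_fst]
        lim[THEN tendsto_snd, THEN tendsto_snd, THEN tendsto_snd, THEN tendsto_snd]
      by (auto simp: U_def o_def)
    have yeq: "ys' = ys" using tendsto_diff[OF lim'(2) sub[OF dy]] lim'(4) LIMSEQ_unique by force
    have zeq: "zs' = zs" using tendsto_diff[OF lim'(3) sub[OF dz]] lim'(5) LIMSEQ_unique by force
    have xlim: "(\<lambda>j. x (s j)) \<longlonglongrightarrow> xs" using tendsto_diff[OF lim'(1) sub[OF dx]] by simp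
    \<comment> \<open>The excess obtained when the minimizer \<open>x (Suc (s j))\<close> competes
      against the fixed point \<open>xs\<close>. It tends to 0 since \<open>p (s j)\<close>
      converges, the matrices are bounded and both iterates approach \<open>xs\<close>.\<close>
    define e where "e j = p (s j) \<bullet> (xs - x (Suc (s j))) + 1 / 2 * ((xs - x (s j)) \<bullet> (Q\<^sub>1 (s j) *v (xs - x (s j))))" for j
    have "e \<longlonglongrightarrow> (G xs + \<alpha> *\<^sub>R (transpose A *v (A *v xs + B *v ys' + c + (1 / \<alpha>) *\<^sub>R zs'))) \<bullet> (xs - xs)
        + 1 / 2 * ((xs - xs) \<bullet> 0)"
      unfolding e_def p_def
    proof (intro tendsto_intros tendsto_mat_vec isCont_tendsto_compose[OF G_cont] lim' xlim)
      have "bdd_above (range (\<lambda>j. opnorm (Q\<^sub>1 (s j))))"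
        by (rule bdd_above_mono[OF A5(6)]) auto
      moreover have "(\<lambda>j. xs - x (s j)) \<longlonglongrightarrow> 0" using tendsto_diff[OF tendsto_const[of xs] xlim] by simp
      ultimately show "(\<lambda>j. Q\<^sub>1 (s j) *v (xs - x (s j))) \<longlonglongrightarrow> 0"
        by (rule tendsto_bounded_mat_vec_zero)
    qed
    then have e0: "e \<longlonglongrightarrow> 0" by simp
    have flim: "(\<lambda>j. f (x (Suc (s j)))) \<longlonglongrightarrow> f xs"
      by (rule lower_semicontinuous_tendsto[OF A1(1) lim'(1) _ e0]) (unfold e_def, rule x_step(3))
    \<comment> \<open>The same sequence has a real limit computed from \<open>l\<close> and
      \<open>S\<close>. Comparing the two limits shows that \<open>f xs\<close> is finite and that
      \<open>R\<close> equals \<open>l\<close> at the limit point.\<close>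
    moreover have "(\<lambda>j. ereal (\<rho> (s j) - S (U (s j)))) \<longlonglongrightarrow> ereal (l - S (xs, ys, zs, ys', zs'))"
      using sub[OF l] isCont_tendsto_compose[OF S_cont lim]
      by (auto intro!: tendsto_intros simp: o_def)
    ultimately have "f xs = ereal (l - S (xs, ys, zs, ys', zs'))"
      unfolding f_eq by (rule LIMSEQ_unique)
    then have "R (xs, ys, zs, ys', zs') = ereal l" by (simp add: R)
    with yeq zeq flim show ?thesis by blast
  qed

  \<comment> \<open>Finite length\<close>
  have "summable d"
  proof (rule KL_summable_steps[where C = C and D = D and u = U and F = R and \<rho> = \<rho> and l = l])
    \<comment> \<open>The KL inequality at \<open>w\<close> holds on a neighbourhood of all of
      \<open>\<Omega>\<close>, which the whole sequence \<open>U\<close> eventually enters, so one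
      limit point is enough.\<close>
    obtain xs ys zs ys' zs' where w: "w = (xs, ys, zs, ys', zs')" by (cases w)
    have "w \<in> \<Omega>" using s by (auto simp: Omega limit_points_def)
    moreover have *: "ys' = ys" "zs' = zs" "R w = ereal l" using limit s w by blast+
    ultimately show "KL_at R \<Omega> w" using KL w by blast
    show "R w = ereal l" by (rule *)
    show "\<forall>\<^sub>F k in sequentially. \<rho> (Suc k) + \<sigma> / 3 * (d (Suc k))\<^sup>2 \<le> \<rho> k"
      using eventually_ge_at_top[of k\<^sub>0] by eventually_elim (rule desc)
    show "\<forall>\<^sub>F k in sequentially. edist_set (U k) \<Omega> < ereal e" if "e > 0" for e
      unfolding Omega using U_bdd that by (rule edist_set_limit_points)
  qed (use RU l d_nonneg sigma D D_le in auto)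

  \<comment> \<open>Convergence of the iterates and stationarity of the limit\<close>
  then have "summable (\<lambda>k. norm (x (Suc k) - x k))" "summable (\<lambda>k. norm (y (Suc k) - y k))"
    "summable (\<lambda>k. norm (z (Suc k) - z k))"
    by (rule summable_comparison_test', simp add: d_def)+
  then obtain xs ys zs where conv: "x \<longlonglongrightarrow> xs" "y \<longlonglongrightarrow> ys" "z \<longlonglongrightarrow> zs"
    using convergent_if_summable_steps unfolding convergent_def by metis
  have "U \<longlonglongrightarrow> (xs, ys, zs, ys, zs)"
    unfolding U_def by (intro tendsto_intros conv conv[THEN LIMSEQ_Suc])
  \<comment> \<open>The analysis of limit points with the identity as subsequence yields convergence
    of the values of \<open>f\<close>, as the definition of the limiting subdifferential
    demands.\<close>
  then have flim: "(\<lambda>k. f (x (Suc k))) \<longlonglongrightarrow> f xs" and R_lim: "R (xs, ys, zs, ys, zs) = ereal l"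
    using limit[of id xs ys zs ys zs] by (auto simp: strict_mono_def)
  have "(\<lambda>k. (1 / (\<alpha> * \<beta>)) *\<^sub>R (z (Suc k) - z k)) \<longlonglongrightarrow> (1 / (\<alpha> * \<beta>)) *\<^sub>R 0"
    by (intro tendsto_intros dz)
  then have res0: "res \<longlonglongrightarrow> 0" by (simp add: res_eq[abs_def])
  have "res \<longlonglongrightarrow> A *v xs + B *v ys + c"
    unfolding res_def by (intro tendsto_intros tendsto_mat_vec conv[THEN LIMSEQ_Suc])
  with res0 have feas: "A *v xs + B *v ys + c = 0" using LIMSEQ_unique by blast
  \<comment> \<open>By \<open>y_step\<close> this sequence is constantly 0, so its limit is the
    stationarity condition in \<open>y\<close>.\<close>
  have "(\<lambda>k. H (y k) + transpose B *v z k + \<alpha> *\<^sub>R (transpose B *v res k) + Q\<^sub>2 k *v (y (Suc k) - y k))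
      \<longlonglongrightarrow> H ys + transpose B *v zs + \<alpha> *\<^sub>R (transpose B *v 0) + 0"
    by (intro tendsto_intros tendsto_mat_vec isCont_tendsto_compose[OF H_cont] conv res0
        tendsto_bounded_mat_vec_zero[OF A5(7) dy])
  then have y_stat: "H ys + transpose B *v zs = 0"
    unfolding y_step by (simp add: LIMSEQ_const_iff)
  have "\<xi> \<longlonglongrightarrow> - (G xs + \<alpha> *\<^sub>R (transpose A *v (A *v xs + B *v ys + c + (1 / \<alpha>) *\<^sub>R zs)) + 0)"
    unfolding \<xi>_def p_def
    by (intro tendsto_intros tendsto_mat_vec isCont_tendsto_compose[OF G_cont] conv
        tendsto_bounded_mat_vec_zero[OF A5(6) dx])
  \<comment> \<open>Feasibility of the limit reduces the linearised penalty to
    \<open>transpose A *v zs\<close>.\<close>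
  then have \<xi>_lim: "\<xi> \<longlonglongrightarrow> - (G xs + transpose A *v zs)"
    using A5 by (simp add: feas matrix_vector_mult_scaleR del: transpose_matrix_vector)
  have "\<bar>f xs\<bar> \<noteq> \<infinity>" using R_lim by (auto simp: R)
  \<comment> \<open>Each \<open>\<xi> k\<close> is a Frechet subgradient of \<open>f\<close> at
    \<open>x (Suc k)\<close>; points, values and subgradients all converge, so the limit is a
    limiting subgradient at \<open>xs\<close>.\<close>
  then have "- (G xs + transpose A *v zs) \<in> limiting_subdiff f xs"
    unfolding limiting_subdiff_def using conv(1)[THEN LIMSEQ_Suc] flim x_step(2) \<xi>_lim by blast
  then have "0 \<in> (\<lambda>u. u + G xs + transpose A *v zs) ` limiting_subdiff f xs"
    by (rule rev_image_eqI) simp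
  with y_stat feas have "stationary_point f G H A B c xs ys zs"
    by (simp add: stationary_point_def)
  with conv \<open>summable d\<close> show ?thesis unfolding d_def by blast
qed

end
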